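(* Let $f:D\subseteq\mathbb{R}\to\mathbb{R}$ be a continuous function which has fractional (Caputo) derivatives of order $j\alpha$, for any positive integer $j$ and any $\alpha\in(0,1]$, in the interval $D$ containing the zero $\bar{x}$ of $f$. Suppose that $cD_{\bar{x}}^{\alpha}f(x)$ is continuous and not null at $\bar{x}$. If the initial approximation $x_0$ is sufficiently close to $\bar{x}$, then the local convergence order of the fractional Newton method of Caputo type $$x_{k+1}=x_k-\left(\Gamma(\alpha+1)\dfrac{f(x_k)}{cD_{\bar{x}}^{\alpha}f(x_k)}\right)^{1/\alpha},\qquad k=0,1,2,\dots$$ is at least $\alpha+1$, where $0<\alpha\leq 1$, and, with $e_k=x_k-\bar{x}$, the error equation is $$e_{k+1}=\dfrac{\Gamma(2\alpha+1)-(\Gamma(\alpha+1))^2}{\alpha(\Gamma(\alpha+1))^2}\,C_2\,e_k^{\alpha+1}+O\left(e_k^{2\alpha+1}\right),$$ where $C_2=\dfrac{\Gamma(\alpha+1)}{\Gamma(2\alpha+1)}\dfrac{cD_{\bar{x}}^{2\alpha}f(\bar{x})}{cD_{\bar{x}}^{\alpha}f(\bar{x})}$.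
   Context: $\Gamma$ is the Gamma function. For $a\in\mathbb{R}$ and $0<\alpha\le 1$, the Caputo fractional derivative of $f$ of order $\alpha$ with base point $a$ is $$cD_a^{\alpha}f(x)=\frac{1}{\Gamma(1-\alpha)}\int_a^x \frac{f'(t)}{(x-t)^{\alpha}}\,dt\quad (0<\alpha<1),\qquad cD_a^{1}f(x)=f'(x).$$ For a positive integer $j$, $cD_a^{j\alpha}$ denotes the $j$-fold composition $cD_a^{\alpha}\cdot cD_a^{\alpha}\cdots cD_a^{\alpha}$ ($j$ times). Values at the base point, such as $cD_{\bar{x}}^{j\alpha}f(\bar{x})$, are the values of the continuous function $x\mapsto cD_{\bar{x}}^{j\alpha}f(x)$ at $x=\bar{x}$ (i.e. its limit as $x\to\bar{x}$). The error at step $k$ is $e_k=x_k-\bar{x}$.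
   Formalization: For α<1, x₀ and the iterates must be ≥ x̄ (else the method is undefined, as happens when C₂<0); error equation holds at each performable step, convergence for runs staying in D. Staying is proved if α=1 with x̄ interior, or α<1 with C₂>0. *)

theory Defs
  imports "HOL-Analysis.Analysis" "HOL-Library.Landau_Symbols"
begin

text \<open>
  Real powers: the ordinary power if the exponent is a natural number (so that negative bases
  are allowed, as needed for order 1), and \<open>powr\<close> otherwise, which is only meaningful for
  nonnegative bases.
\<close>

definition rpow :: "real \<Rightarrow> real \<Rightarrow> real" where
  "rpow x p = (if p \<in> \<nat> then x ^ nat \<lfloor>p\<rfloor> else x powr p)"

text \<open>
  Throughout, \<open>D\<close> is the interval on which \<open>f\<close> is given. Derivatives are taken within \<open>D\<close>, so that
  they are one-sided at an endpoint of \<open>D\<close> and do not depend on values of \<open>f\<close> outside \<open>D\<close>.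

  For an order below 1 the kernel \<open>(x - t)\<^sup>-\<^sup>\<alpha>\<close> is real only if \<open>x\<close> is to the right of the base point;
  for order 1 there is no such restriction.
\<close>

definition caputo_dom :: "real set \<Rightarrow> real \<Rightarrow> real \<Rightarrow> real set" where
  "caputo_dom D a \<alpha> = (if \<alpha> = 1 then D else D \<inter> {a..})"

definition caputo_integrand :: "real set \<Rightarrow> real \<Rightarrow> (real \<Rightarrow> real) \<Rightarrow> real \<Rightarrow> real \<Rightarrow> real" where
  "caputo_integrand D \<alpha> f x t = vector_derivative f (at t within D) / (x - t) powr \<alpha>"

definition caputo_formula :: "real set \<Rightarrow> real \<Rightarrow> real \<Rightarrow> (real \<Rightarrow> real) \<Rightarrow> real \<Rightarrow> real" where
  "caputo_formula D a \<alpha> f x =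
     1 / Gamma (1 - \<alpha>) * (LBINT t:{a<..<x}. caputo_integrand D \<alpha> f x t)"

text \<open>
  For order below 1, the value at the base point is by convention the limit from the right (the
  formula itself, an integral over an empty interval, would give 0 there).
\<close>

definition caputo_deriv :: "real set \<Rightarrow> real \<Rightarrow> real \<Rightarrow> (real \<Rightarrow> real) \<Rightarrow> real \<Rightarrow> real" where
  "caputo_deriv D a \<alpha> f x =
     (if \<alpha> = 1 then vector_derivative f (at x within D)
      else if x = a then Lim (at_right a) (caputo_formula D a \<alpha> f)
      else caputo_formula D a \<alpha> f x)"

text \<open>The \<open>j\<close>-fold composition, i.e. the sequential derivative of order \<open>j\<alpha>\<close>.\<close>

definition caputo_iter :: "real set \<Rightarrow> real \<Rightarrow> real \<Rightarrow> nat \<Rightarrow> (real \<Rightarrow> real) \<Rightarrow> real \<Rightarrow> real" where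
  "caputo_iter D a \<alpha> j f = (caputo_deriv D a \<alpha> ^^ j) f"

definition caputo_differentiable :: "real set \<Rightarrow> real \<Rightarrow> real \<Rightarrow> (real \<Rightarrow> real) \<Rightarrow> bool" where
  "caputo_differentiable D a \<alpha> f \<longleftrightarrow>
     (if \<alpha> = 1 then f differentiable_on D
      else \<forall>x\<in>D. a < x \<longrightarrow>
             f differentiable_on {a<..<x} \<and>
             set_integrable lborel {a<..<x} (caputo_integrand D \<alpha> f x))"

text \<open>
  Derivatives of order \<open>j\<alpha>\<close> exist for every positive integer \<open>j\<close> and are continuous. Continuity at
  \<open>a\<close> says in particular that the limit defining the value at the base point exists.
\<close>

definition has_caputo_derivs :: "real set \<Rightarrow> real \<Rightarrow> real \<Rightarrow> (real \<Rightarrow> real) \<Rightarrow> bool" where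
  "has_caputo_derivs D a \<alpha> f \<longleftrightarrow>
     (\<forall>j\<ge>1. caputo_differentiable D a \<alpha> (caputo_iter D a \<alpha> (j - 1) f) \<and>
             continuous_on (caputo_dom D a \<alpha>) (caputo_iter D a \<alpha> j f))"

definition newton_radicand :: "real set \<Rightarrow> real \<Rightarrow> real \<Rightarrow> (real \<Rightarrow> real) \<Rightarrow> real \<Rightarrow> real" where
  "newton_radicand D a \<alpha> f x = Gamma (\<alpha> + 1) * (f x / caputo_iter D a \<alpha> 1 f x)"

definition newton_step :: "real set \<Rightarrow> real \<Rightarrow> real \<Rightarrow> (real \<Rightarrow> real) \<Rightarrow> real \<Rightarrow> real" where
  "newton_step D a \<alpha> f x = x - rpow (newton_radicand D a \<alpha> f x) (1 / \<alpha>)"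

text \<open>
  A run of the method continues as long as the iterates stay where the Caputo derivative is
  defined; nothing is required of the sequence after it has left that set.
\<close>

definition newton_run :: "real set \<Rightarrow> real \<Rightarrow> real \<Rightarrow> (real \<Rightarrow> real) \<Rightarrow> (nat \<Rightarrow> real) \<Rightarrow> bool" where
  "newton_run D a \<alpha> f x \<longleftrightarrow>
     x 0 \<in> caputo_dom D a \<alpha> \<and>
     (\<forall>k. (\<forall>i\<le>k. x i \<in> caputo_dom D a \<alpha>) \<longrightarrow> x (Suc k) = newton_step D a \<alpha> f (x k))"

definition C2 :: "real set \<Rightarrow> real \<Rightarrow> real \<Rightarrow> (real \<Rightarrow> real) \<Rightarrow> real" where
  "C2 D a \<alpha> f = Gamma (\<alpha> + 1) / Gamma (2 * \<alpha> + 1) *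
                 (caputo_iter D a \<alpha> 2 f a / caputo_iter D a \<alpha> 1 f a)"

definition conv_order_at_least :: "(nat \<Rightarrow> real) \<Rightarrow> real \<Rightarrow> real \<Rightarrow> bool" where
  "conv_order_at_least x L p \<longleftrightarrow>
     x \<longlonglongrightarrow> L \<and> (\<lambda>k. x (Suc k) - L) \<in> O(\<lambda>k. \<bar>x k - L\<bar> powr p)"

end

theory Submission
  imports Defs
begin

text \<open>
  Write \<open>e = x - a\<close>, where \<open>a\<close> is the zero, and \<open>s = e\<^sup>\<alpha>\<close>. By Fubini and the Beta integral, the
  Riemann-Liouville integral of order \<open>\<alpha>\<close> inverts the Caputo derivative. Since the derivative of
  order \<open>3\<alpha>\<close> is continuous, hence bounded near \<open>a\<close>, integrating three times gives
  \<open>f = G s / \<Gamma>(\<alpha> + 1) + H s\<^sup>2 / \<Gamma>(2\<alpha> + 1) + O(s\<^sup>3)\<close> and \<open>D\<^sup>\<alpha> f = G + H s / \<Gamma>(\<alpha> + 1) + O(s\<^sup>2)\<close>, with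
  \<open>G\<close> and \<open>H\<close> the values at \<open>a\<close> of the derivatives of order \<open>\<alpha>\<close> and \<open>2\<alpha>\<close>. So the radicand of the
  Newton step is \<open>s (1 + c s + O(s\<^sup>2))\<close>, its power \<open>1 / \<alpha>\<close> is \<open>e (1 + c s / \<alpha> + O(s\<^sup>2))\<close>, and the new
  error is \<open>- (c / \<alpha>) e s + O(e s\<^sup>2)\<close>. The iterates stay to the right of \<open>a\<close> when \<open>C\<^sub>2 > 0\<close> because
  \<open>\<Gamma>(\<alpha> + 1)\<^sup>2 < \<Gamma>(2\<alpha> + 1)\<close>.
\<close>

section \<open>Beta integrals and the inversion of the Caputo derivative for orders below 1\<close>

lemma has_bochner_integral_Beta:
  fixes p q :: real
  assumes "p > 0" "q > 0"
  shows "has_bochner_integral lborel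
    (\<lambda>t. indicator {0<..<1} t * ((1 - t) powr (p - 1) * t powr (q - 1))) (Beta p q)"
proof -
  let ?f = "\<lambda>t::real. (1 - t) powr (p - 1) * t powr (q - 1)"
  have hi: "(?f has_integral Beta p q) {0<..<1}"
    using has_integral_Beta_real[OF assms(2,1)]
    by (simp add: has_integral_Icc_iff_Ioo mult.commute Beta_commute)
  \<comment> \<open>The Beta integral is given as a gauge integral; nonnegativity of the integrand
    makes it a Lebesgue integral too.\<close>
  then have "?f absolutely_integrable_on {0<..<1}"
    by (intro nonnegative_absolutely_integrable_1) (auto simp: integrable_on_def)
  then have "set_integrable lborel {0<..<1} ?f"
    unfolding set_integrable_def by (subst (asm) integrable_completion) simp_all
  moreover from set_borel_integral_eq_integral(2)[OF this] hi
  have "(LINT t:{0<..<1}|lborel. ?f t) = Beta p q"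
    by (simp add: integral_unique)
  ultimately show ?thesis
    by (simp add: has_bochner_integral_iff set_integrable_def set_lebesgue_integral_def)
qed

text \<open>Substitute \<open>a + c * t\<close> with \<open>c = x - a\<close>: the two factors
  release \<open>c powr (p + q - 2)\<close> and the change of measure one more \<open>c\<close>. Two
  instances matter: \<open>p + q = 1\<close>, where the value does not depend on the interval, and
  \<open>p = \<alpha>\<close>, \<open>q = b + 1\<close>, which integrates powers of
  \<open>t - a\<close>.\<close>

lemma has_bochner_integral_Beta_scaled:
  fixes p q a x :: real
  assumes "p > 0" "q > 0" "a < x"
  shows "has_bochner_integral lborel
    (\<lambda>t. indicator {a<..<x} t * ((x - t) powr (p - 1) * (t - a) powr (q - 1)))
    (Beta p q * (x - a) powr (p + q - 1))"
proof -
  define c where "c = x - a"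
  have c: "c > 0" using assms by (simp add: c_def)
  let ?g = "\<lambda>t. indicator {a<..<x} t * ((x - t) powr (p - 1) * (t - a) powr (q - 1))"
  have *: "?g (a + c * t) = c powr (p + q - 2) *
      (indicator {0<..<1} t * ((1 - t) powr (p - 1) * t powr (q - 1)))" for t
  proof (cases "t \<in> {0<..<1}")
    case True
    have "c * t < c * 1" using c True by (intro mult_strict_left_mono) auto
    moreover have "a + c = x" "0 < c * t" using c True by (simp_all add: c_def)
    ultimately have "a + c * t \<in> {a<..<x}" by simp
    moreover have "x - (a + c * t) = c * (1 - t)" by (simp add: c_def algebra_simps)
    moreover have "c powr (p + q - 2) = c powr (p - 1) * c powr (q - 1)"
      by (simp add: powr_add[symmetric])
    ultimately show ?thesis
      using True c by (simp add: powr_mult)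
  next
    case False
    moreover have "c * t < c * 1 \<longleftrightarrow> t < 1" "0 < c * t \<longleftrightarrow> 0 < t" "a + c = x"
      using c by (simp_all add: c_def zero_less_mult_iff)
    ultimately have "a + c * t \<notin> {a<..<x}" by auto
    then show ?thesis using False by simp
  qed
  have "has_bochner_integral lborel (\<lambda>t. ?g (a + c * t)) (c powr (p + q - 2) * Beta p q)"
    unfolding * by (intro has_bochner_integral_mult_right has_bochner_integral_Beta assms)
  moreover have "c powr (p + q - 2) * Beta p q = (Beta p q * c powr (p + q - 1)) /\<^sub>R \<bar>c\<bar>"
  proof -
    have "c powr (p + q - 1) = c powr (p + q - 2) * c powr 1"
      unfolding powr_add[symmetric] by simp
    then show ?thesis using c by simp
  qed
  ultimately show ?thesis
    using lborel_has_bochner_integral_real_affine_iff[of c ?g "Beta p q * c powr (p + q - 1)" a] c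
    unfolding c_def[symmetric] by (metis order_less_irrefl)
qed

text \<open>The derivative may blow up at \<open>a\<close>, as that of
  \<open>(t - a) powr \<alpha>\<close> does, so it is only assumed to exist inside the interval; the
  separate integrability assumption turns the gauge integral of the fundamental theorem into a
  Lebesgue integral.\<close>

lemma has_bochner_integral_derivative:
  fixes u d :: "real \<Rightarrow> real"
  assumes "a \<le> x" "continuous_on {a..x} u"
    and "\<And>t. t \<in> {a<..<x} \<Longrightarrow> (u has_vector_derivative d t) (at t)"
    and "set_integrable lborel {a<..<x} d"
  shows "has_bochner_integral lborel (\<lambda>t. indicator {a<..<x} t * d t) (u x - u a)"
proof -
  have "(d has_integral (u x - u a)) {a..x}"
    by (rule fundamental_theorem_of_calculus_interior[OF assms(1-3)])
  then have "integral {a<..<x} d = u x - u a"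
    by (simp add: has_integral_Icc_iff_Ioo integral_unique)
  with set_borel_integral_eq_integral(2)[OF assms(4)] assms(4) show ?thesis
    by (simp add: has_bochner_integral_iff set_integrable_def set_lebesgue_integral_def)
qed

text \<open>Abel's argument: the left side is a double integral over \<open>a < s < t < x\<close>.
  Integrating over \<open>t\<close> first leaves, for each \<open>s\<close>, the Beta integral of
  exponents \<open>\<alpha>\<close> and \<open>1 - \<alpha>\<close> on \<open>{s<..<x}\<close>,
  which is the same constant for every \<open>s\<close> and factors out of the integral of
  \<open>d\<close>.\<close>

lemma abel_inversion:
  fixes d :: "real \<Rightarrow> real"
  assumes \<alpha>: "0 < \<alpha>" "\<alpha> < 1" and "a < x"
    and d: "has_bochner_integral lborel (\<lambda>t. indicator {a<..<x} t * d t) I"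
  shows "has_bochner_integral lborel
    (\<lambda>t. indicator {a<..<x} t * ((x - t) powr (\<alpha> - 1) *
       (LBINT s:{a<..<t}. d s / (t - s) powr \<alpha>))) (Gamma \<alpha> * Gamma (1 - \<alpha>) * I)"
proof -
  define e where "e = (\<lambda>t. indicator {a<..<x} t * d t)"
  have e: "integrable lborel e" "integral\<^sup>L lborel e = I"
    using d by (simp_all add: e_def has_bochner_integral_iff)
  have [measurable]: "e \<in> borel_measurable borel"
    using e(1) by simp
  define k where "k = (\<lambda>s t. indicator {s<..<x} t * ((x - t) powr (\<alpha> - 1) * (t - s) powr (- \<alpha>)))"
  have k: "has_bochner_integral lborel (k s) (Gamma \<alpha> * Gamma (1 - \<alpha>))" if "s < x" for s
    using has_bochner_integral_Beta_scaled[of \<alpha> "1 - \<alpha>" s x] \<alpha> that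
    by (simp add: k_def Beta_def)
  have k0: "k s t \<ge> 0" for s t by (simp add: k_def)
  \<comment> \<open>Written as a condition on the pair \<open>(s, t)\<close>, the kernel is seen to
    be jointly measurable.\<close>
  have k_alt: "k = (\<lambda>s t. if s < t \<and> t < x then (x - t) powr (\<alpha> - 1) * (t - s) powr (- \<alpha>) else 0)"
    by (auto simp: k_def fun_eq_iff)
  have k_meas: "(\<lambda>(s, t). k s t) \<in> borel_measurable (lborel \<Otimes>\<^sub>M lborel)"
    unfolding k_alt by measurable
  have ek: "has_bochner_integral lborel (\<lambda>t. e s * k s t) (Gamma \<alpha> * Gamma (1 - \<alpha>) * e s)" for s
  proof (cases "s < x")
    case True
    from has_bochner_integral_mult_right[OF k[OF this], of "e s"] show ?thesis
      by (simp add: mult.commute)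
  next
    case False
    then show ?thesis by (auto simp: e_def)
  qed
  \<comment> \<open>The same computation with absolute values gives the finite iterated integral
    that Fubini requires.\<close>
  have nek: "has_bochner_integral lborel (\<lambda>t. \<bar>e s * k s t\<bar>) (Gamma \<alpha> * Gamma (1 - \<alpha>) * \<bar>e s\<bar>)" for s
  proof (cases "s < x")
    case True
    from has_bochner_integral_mult_right[OF k[OF this], of "\<bar>e s\<bar>"] show ?thesis
      using k0[of s] by (simp add: mult.commute abs_mult)
  next
    case False
    then show ?thesis by (auto simp: e_def)
  qed
  have int: "integrable (lborel \<Otimes>\<^sub>M lborel) (\<lambda>(s, t). e s * k s t)"
  proof (rule lborel_pair.Fubini_integrable)
    show "(\<lambda>(s, t). e s * k s t) \<in> borel_measurable (lborel \<Otimes>\<^sub>M lborel)"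
      using k_meas by measurable
    show "integrable lborel (\<lambda>s. LBINT t. norm (case (s, t) of (s, t) \<Rightarrow> e s * k s t))"
      using e(1) by (simp add: has_bochner_integral_integral_eq[OF nek])
    show "AE s in lborel. integrable lborel (\<lambda>t. case (s, t) of (s, t) \<Rightarrow> e s * k s t)"
      unfolding prod.case by (rule AE_I2, rule integrable.intros[OF ek])
  qed
  \<comment> \<open>The cutoff \<open>s < x\<close> in \<open>e\<close> may be replaced by
    \<open>s < t\<close>, since the kernel vanishes unless \<open>s < t\<close> and
    \<open>t < x\<close>.\<close>
  have inner: "(LBINT s. e s * k s t) = indicator {a<..<x} t * ((x - t) powr (\<alpha> - 1) *
       (LBINT s:{a<..<t}. d s / (t - s) powr \<alpha>))" for t
  proof -
    have "e s * k s t = (indicator {a<..<x} t * (x - t) powr (\<alpha> - 1)) *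
        (indicator {a<..<t} s *\<^sub>R (d s / (t - s) powr \<alpha>))" for s
      by (auto simp: e_def k_def indicator_def powr_minus field_simps)
    then have "(LBINT s. e s * k s t) = (indicator {a<..<x} t * (x - t) powr (\<alpha> - 1)) *
        (LBINT s:{a<..<t}. d s / (t - s) powr \<alpha>)"
      unfolding set_lebesgue_integral_def by (simp only: integral_mult_right_zero)
    then show ?thesis by (simp only: mult.assoc)
  qed
  have "(LBINT t. LBINT s. e s * k s t) = (LBINT s. LBINT t. e s * k s t)"
    by (rule lborel_pair.Fubini_integral[OF int])
  also have "\<dots> = Gamma \<alpha> * Gamma (1 - \<alpha>) * I"
    unfolding has_bochner_integral_integral_eq[OF ek] unfolding integral_mult_right_zero e(2) ..
  finally show ?thesis
    using lborel_pair.integrable_snd[OF int] by (simp add: has_bochner_integral_iff inner)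
qed

text \<open>Abel inversion applied to the derivative of \<open>u\<close>, whose integral is
  \<open>u x - u a\<close>; the factor \<open>Gamma (1 - \<alpha>)\<close> cancels against the
  normalisation in \<open>caputo_formula\<close>.\<close>

lemma caputo_fundamental_theorem:
  fixes u :: "real \<Rightarrow> real"
  assumes "is_interval D" "a \<in> D" "x \<in> D" "a < x" "0 < \<alpha>" "\<alpha> < 1"
    and u: "continuous_on (D \<inter> {a..}) u" "caputo_differentiable D a \<alpha> u"
  shows "has_bochner_integral lborel
    (\<lambda>t. indicator {a<..<x} t * ((x - t) powr (\<alpha> - 1) * caputo_formula D a \<alpha> u t))
    (Gamma \<alpha> * (u x - u a))"
proof -
  let ?d = "\<lambda>t. vector_derivative u (at t within D)"
  have sub: "{a..x} \<subseteq> D"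
    using assms(1-4) by (meson atLeastAtMost_iff mem_is_interval_1_I subsetI)
  have d: "(u has_vector_derivative ?d t) (at t)" if "t \<in> {a<..<x}" for t
  proof -
    \<comment> \<open>At interior points the derivative within \<open>D\<close> is the ordinary
      two-sided one.\<close>
    have int: "t \<in> interior D"
      using that sub by (meson greaterThanLessThan_subseteq_atLeastAtMost_iff interior_maximal
          open_greaterThanLessThan order_refl subset_iff order_trans)
    have "u differentiable at t"
      using u(2) assms(3,4,6) that
      by (auto simp: caputo_differentiable_def differentiable_on_eq_differentiable_at)
    then show ?thesis
      unfolding at_within_interior[OF int] by (rule vector_derivative_works[THEN iffD1])
  qed
  \<comment> \<open>Only the quotient by \<open>(x - t) powr \<alpha>\<close> is known to be
    integrable; multiplying back by this factor, which is at most
    \<open>(x - a) powr \<alpha>\<close>, keeps integrability.\<close>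
  have "set_integrable lborel {a<..<x} ?d"
  proof -
    let ?i = "\<lambda>t. indicator {a<..<x} t *\<^sub>R caputo_integrand D \<alpha> u x t"
    let ?e = "\<lambda>t. (if a < t \<and> t < x then (x - t) powr \<alpha> else 0) * ?i t"
    have i: "integrable lborel ?i"
      using u(2) assms(3,4,6) by (auto simp: caputo_differentiable_def set_integrable_def)
    have "integrable lborel ?e"
    proof (rule Bochner_Integration.integrable_bound)
      show "integrable lborel (\<lambda>t. (x - a) powr \<alpha> * ?i t)"
        using i by simp
      show "?e \<in> borel_measurable lborel"
        using borel_measurable_integrable[OF i] by measurable
      show "AE t in lborel. norm (?e t) \<le> norm ((x - a) powr \<alpha> * ?i t)"
        using assms(5) by (intro AE_I2) (auto simp: abs_mult intro!: mult_right_mono powr_mono2)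
    qed
    also have "?e = (\<lambda>t. indicator {a<..<x} t *\<^sub>R ?d t)"
      by (auto simp: fun_eq_iff caputo_integrand_def indicator_def)
    finally show ?thesis by (simp add: set_integrable_def)
  qed
  moreover have "continuous_on {a..x} u"
    using u(1) by (rule continuous_on_subset) (use sub in auto)
  ultimately have "has_bochner_integral lborel (\<lambda>t. indicator {a<..<x} t * ?d t) (u x - u a)"
    using d assms(4) by (intro has_bochner_integral_derivative) auto
  from abel_inversion[OF assms(5,6,4) this]
  have "has_bochner_integral lborel (\<lambda>t. 1 / Gamma (1 - \<alpha>) * (indicator {a<..<x} t *
      ((x - t) powr (\<alpha> - 1) * (LBINT s:{a<..<t}. ?d s / (t - s) powr \<alpha>))))
      (1 / Gamma (1 - \<alpha>) * (Gamma \<alpha> * Gamma (1 - \<alpha>) * (u x - u a)))"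
    by (intro has_bochner_integral_mult_right)
  moreover have "Gamma (1 - \<alpha>) \<noteq> 0"
    using Gamma_real_pos[of "1 - \<alpha>"] assms(6) by linarith
  ultimately show ?thesis
    by (simp add: caputo_formula_def caputo_integrand_def mult.left_commute)
qed

text \<open>One fractional integration of an expansion of the derivative: each power of
  \<open>t - a\<close> gains \<open>\<alpha>\<close> in its exponent and a quotient of Gamma values.
  The kernel is nonnegative, so the error bound is integrated in the same way. The bound is required
  only for \<open>t > a\<close>, which admits \<open>\<beta> = 0\<close>.\<close>

lemma caputo_expansion:
  fixes u :: "real \<Rightarrow> real"
  assumes "is_interval D" "a \<in> D" "x \<in> D" "a < x" "0 < \<alpha>" "\<alpha> < 1"
    and u: "continuous_on (D \<inter> {a..}) u" "caputo_differentiable D a \<alpha> u"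
    and "\<beta> \<ge> 0"
    and bound: "\<And>t. t \<in> {a<..<x} \<Longrightarrow>
      \<bar>caputo_deriv D a \<alpha> u t - (p + q * (t - a) powr \<alpha>)\<bar> \<le> K * (t - a) powr \<beta>"
  shows "\<bar>u x - u a - (p / Gamma (\<alpha> + 1) * (x - a) powr \<alpha>
      + q * Gamma (\<alpha> + 1) / Gamma (2 * \<alpha> + 1) * (x - a) powr (2 * \<alpha>))\<bar>
    \<le> K * Gamma (\<beta> + 1) / Gamma (\<alpha> + \<beta> + 1) * (x - a) powr (\<alpha> + \<beta>)"
proof -
  have pos: "Gamma \<alpha> > 0"
    using assms(5) by simp
  let ?w = "\<lambda>g t. indicator {a<..<x} t * ((x - t) powr (\<alpha> - 1) * g t)"
  define J where "J b = Gamma \<alpha> * (Gamma (b + 1) / Gamma (\<alpha> + b + 1) * (x - a) powr (\<alpha> + b))" for b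
  have J: "has_bochner_integral lborel (?w (\<lambda>t. (t - a) powr b)) (J b)" if "b \<ge> 0" for b
    using has_bochner_integral_Beta_scaled[of \<alpha> "b + 1" a x] that assms(4,5)
    by (simp add: J_def Beta_def add.assoc mult.assoc)
  \<comment> \<open>The constant function is \<open>(t - a) powr 0\<close> only for \<open>t\<close>
    different from \<open>a\<close>; the indicator removes that point.\<close>
  have J0: "has_bochner_integral lborel (?w (\<lambda>t. 1)) (J 0)"
    using J[of 0] by (rule back_subst[where P = "\<lambda>g. has_bochner_integral lborel g _"])
      (auto simp: fun_eq_iff indicator_def)
  let ?v = "caputo_formula D a \<alpha> u"
  have err: "has_bochner_integral lborel
     (\<lambda>t. ?w ?v t - (p * ?w (\<lambda>t. 1) t + q * ?w (\<lambda>t. (t - a) powr \<alpha>) t))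
     (Gamma \<alpha> * (u x - u a) - (p * J 0 + q * J \<alpha>))" (is "has_bochner_integral _ ?E ?I")
    using assms(5) by (intro has_bochner_integral_diff has_bochner_integral_add
        has_bochner_integral_mult_right J J0 caputo_fundamental_theorem[OF assms(1-8)]) simp
  have "\<bar>?I\<bar> \<le> K * J \<beta>"
  proof -
    have "norm (integral\<^sup>L lborel ?E) \<le> (LBINT t. norm (?E t))"
      by (rule integral_norm_bound)
    also have "\<dots> \<le> (LBINT t. K * ?w (\<lambda>t. (t - a) powr \<beta>) t)"
    proof (rule integral_mono)
      show "integrable lborel (\<lambda>t. norm (?E t))"
        using err by (intro integrable_norm integrable.intros)
      show "integrable lborel (\<lambda>t. K * ?w (\<lambda>t. (t - a) powr \<beta>) t)"
        using J[OF assms(9)] by (intro integrable_mult_right integrable.intros)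
      show "norm (?E t) \<le> K * ?w (\<lambda>t. (t - a) powr \<beta>) t" for t
      proof (cases "t \<in> {a<..<x}")
        case True
        have "norm (?E t) = (x - t) powr (\<alpha> - 1) * \<bar>?v t - (p + q * (t - a) powr \<alpha>)\<bar>"
        proof -
          have "?E t = (x - t) powr (\<alpha> - 1) * (?v t - (p + q * (t - a) powr \<alpha>))"
            using True by (simp add: algebra_simps)
          then show ?thesis by (simp only: abs_mult real_norm_def abs_of_nonneg[OF powr_ge_zero])
        qed
        also have "\<dots> \<le> (x - t) powr (\<alpha> - 1) * (K * (t - a) powr \<beta>)"
          using bound[OF True] True assms(6)
          by (intro mult_left_mono) (auto simp: caputo_deriv_def)
        finally show ?thesis using True by (simp add: mult_ac)
      qed simp
    qed
    finally show ?thesis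
      using has_bochner_integral_integral_eq[OF err] has_bochner_integral_integral_eq[OF J[OF assms(9)]]
      by simp
  qed
  also have "K * J \<beta> = Gamma \<alpha> * (K * Gamma (\<beta> + 1) / Gamma (\<alpha> + \<beta> + 1) * (x - a) powr (\<alpha> + \<beta>))"
    by (simp add: J_def)
  also have "?I = Gamma \<alpha> * (u x - u a - (p / Gamma (\<alpha> + 1) * (x - a) powr \<alpha>
      + q * Gamma (\<alpha> + 1) / Gamma (2 * \<alpha> + 1) * (x - a) powr (2 * \<alpha>)))"
    by (simp add: J_def algebra_simps mult_2)
  finally show ?thesis
    by (simp only: abs_mult abs_of_pos[OF pos] mult_le_cancel_left_pos[OF pos])
qed

section \<open>Real powers and bounds near a point\<close>

lemma rpow_1 [simp]: "rpow x 1 = x"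
  by (simp add: rpow_def)

text \<open>The condition \<open>p > 0\<close> guards the base 0, where \<open>0 ^ 0 = 1\<close> but
  \<open>0 powr 0 = 0\<close>.\<close>

lemma rpow_nonneg_base:
  assumes "x \<ge> 0" "p > 0"
  shows "rpow x p = x powr p"
proof (cases "p \<in> \<nat>")
  case True
  then obtain n where n: "p = real n" by (auto elim: Nats_cases)
  then show ?thesis
    using assms by (cases "x = 0") (auto simp: rpow_def powr_realpow)
qed (simp add: rpow_def)

lemma closed_segment_dist_less:
  fixes a x t :: real
  assumes "t \<in> closed_segment a x"
  shows "\<bar>t - a\<bar> \<le> \<bar>x - a\<bar>"
  using assms by (auto simp: closed_segment_eq_real_ivl split: if_splits)

text \<open>The mean value inequality on the segment from \<open>a\<close> to \<open>x\<close>,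
  where \<open>\<bar>t - a\<bar>\<close> is at most \<open>\<bar>x - a\<bar>\<close>. Each use
  raises the order of a Taylor remainder by one, on either side of \<open>a\<close> and with
  one-sided derivatives at the ends of \<open>S\<close>.\<close>

lemma deviation_le_power:
  fixes u u' :: "real \<Rightarrow> real"
  assumes "is_interval S" "a \<in> S" "x \<in> S"
    and deriv: "\<And>t. t \<in> S \<Longrightarrow> (u has_real_derivative u' t) (at t within S)"
    and bound: "\<And>t. t \<in> closed_segment a x \<Longrightarrow> \<bar>u' t\<bar> \<le> K * \<bar>t - a\<bar> ^ n" and "K \<ge> 0"
  shows "\<bar>u x - u a\<bar> \<le> K * \<bar>x - a\<bar> ^ Suc n"
proof -
  let ?C = "closed_segment a x"
  have sub: "?C \<subseteq> S"
    using assms(1-3) by (simp add: closed_segment_subset is_interval_convex)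
  have "norm (u x - u a) \<le> (K * \<bar>x - a\<bar> ^ n) * norm (x - a)"
  proof (rule field_differentiable_bound)
    show "convex ?C" "x \<in> ?C" "a \<in> ?C" by simp_all
    show "(u has_real_derivative u' t) (at t within ?C)" if "t \<in> ?C" for t
      using deriv that sub by (meson DERIV_subset subsetD)
    show "norm (u' t) \<le> K * \<bar>x - a\<bar> ^ n" if "t \<in> ?C" for t
    proof -
      have "\<bar>t - a\<bar> \<le> \<bar>x - a\<bar>"
        using that by (rule closed_segment_dist_less)
      then show ?thesis
        using bound[OF that] assms(6) unfolding real_norm_def by (meson abs_ge_zero mult_left_mono order_trans power_mono)
    qed
  qed
  then show ?thesis by (simp add: mult_ac)
qed

lemma continuous_on_locally_bounded:
  fixes w :: "real \<Rightarrow> real"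
  assumes "continuous_on X w" "a \<in> X"
  obtains K \<eta> where "K \<ge> 0" "\<eta> > 0" "\<And>x. x \<in> X \<Longrightarrow> \<bar>x - a\<bar> < \<eta> \<Longrightarrow> \<bar>w x\<bar> \<le> K"
proof -
  obtain \<eta> where "\<eta> > 0" and \<eta>: "\<And>x. x \<in> X \<Longrightarrow> dist x a < \<eta> \<Longrightarrow> dist (w x) (w a) < 1"
    using assms by (metis continuous_on_iff zero_less_one)
  show thesis
  proof (rule that[of "\<bar>w a\<bar> + 1" \<eta>])
    show "\<bar>w x\<bar> \<le> \<bar>w a\<bar> + 1" if "x \<in> X" "\<bar>x - a\<bar> < \<eta>" for x
      using \<eta>[of x] that by (auto simp: dist_real_def)
  qed (use \<open>\<eta> > 0\<close> in auto)
qed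

section \<open>Fractional Taylor expansions of the function and of its first Caputo
  derivative\<close>

lemma has_caputo_derivsD:
  assumes "has_caputo_derivs D a \<alpha> f"
  shows "caputo_differentiable D a \<alpha> (caputo_iter D a \<alpha> j f)"
    and "continuous_on (caputo_dom D a \<alpha>) (caputo_iter D a \<alpha> (Suc j) f)"
  using assms[unfolded has_caputo_derivs_def, rule_format, of "Suc j"] by auto

lemma caputo_iter_Suc: "caputo_iter D a \<alpha> (Suc j) f = caputo_deriv D a \<alpha> (caputo_iter D a \<alpha> j f)"
  by (simp add: caputo_iter_def)

text \<open>For order 1 the iterates are ordinary derivatives within \<open>D\<close> and
  \<open>x\<close> may lie on either side of \<open>a\<close>. The third one is continuous, hence
  bounded near \<open>a\<close>, and \<open>deviation_le_power\<close> is applied three times going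
  down.\<close>

lemma caputo_taylor_1:
  fixes f :: "real \<Rightarrow> real" and a :: real and D :: "real set"
  defines "F \<equiv> \<lambda>j. caputo_iter D a 1 j f"
  assumes "is_interval D" "a \<in> D" "has_caputo_derivs D a 1 f"
  obtains K \<eta> where "\<eta> > 0"
    "\<And>x. x \<in> D \<Longrightarrow> \<bar>x - a\<bar> < \<eta> \<Longrightarrow> \<bar>F 1 x - (F 1 a + F 2 a * (x - a))\<bar> \<le> K * \<bar>x - a\<bar>\<^sup>2"
    "\<And>x. x \<in> D \<Longrightarrow> \<bar>x - a\<bar> < \<eta> \<Longrightarrow>
      \<bar>f x - (f a + F 1 a * (x - a) + F 2 a / 2 * (x - a)\<^sup>2)\<bar> \<le> K * \<bar>x - a\<bar> ^ 3"
proof -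
  have deriv: "(F j has_real_derivative F (Suc j) t) (at t within D)" if "t \<in> D" for j t
    using has_caputo_derivsD(1)[OF assms(4), of j] that
    by (simp add: F_def caputo_iter_Suc caputo_differentiable_def caputo_deriv_def differentiable_on_def
        vector_derivative_works[symmetric] has_real_derivative_iff_has_vector_derivative)
  have "continuous_on D (F 3)"
    using has_caputo_derivsD(2)[OF assms(4), of 2] by (simp add: F_def caputo_dom_def numeral_3_eq_3)
  then obtain K \<eta> where K: "K \<ge> 0" "\<eta> > 0" "\<And>x. x \<in> D \<Longrightarrow> \<bar>x - a\<bar> < \<eta> \<Longrightarrow> \<bar>F 3 x\<bar> \<le> K"
    using assms(3) by (metis continuous_on_locally_bounded)
  have sub: "t \<in> D" "\<bar>t - a\<bar> < \<eta>" if "t \<in> closed_segment a x" "x \<in> D" "\<bar>x - a\<bar> < \<eta>" for t x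
    using that assms(2,3) closed_segment_subset[of a D x] closed_segment_dist_less[of t a x]
    by (auto simp: is_interval_convex)
  have F2: "\<bar>F 2 x - F 2 a\<bar> \<le> K * \<bar>x - a\<bar> ^ Suc 0" if "x \<in> D" "\<bar>x - a\<bar> < \<eta>" for x
    using assms(2,3) that(1) deriv[of _ 2] K(1) K(3) sub[OF _ that]
    by (intro deviation_le_power[where u' = "F 3" and S = D]) (auto simp: numeral_3_eq_3)
  let ?r = "\<lambda>x. F 1 x - (F 1 a + F 2 a * (x - a))"
  have F1: "\<bar>?r x - ?r a\<bar> \<le> K * \<bar>x - a\<bar> ^ Suc (Suc 0)" if "x \<in> D" "\<bar>x - a\<bar> < \<eta>" for x
  proof (rule deviation_le_power[OF assms(2,3) that(1) _ _ K(1)])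
    show "(?r has_real_derivative F 2 t - F 2 a) (at t within D)" if "t \<in> D" for t
      using deriv[OF that, of 1] by (auto intro!: derivative_eq_intros simp: numeral_2_eq_2)
    show "\<bar>F 2 t - F 2 a\<bar> \<le> K * \<bar>t - a\<bar> ^ Suc 0" if "t \<in> closed_segment a x" for t
      using F2 sub[OF that] \<open>x \<in> D\<close> \<open>\<bar>x - a\<bar> < \<eta>\<close> by blast
  qed
  \<comment> \<open>The derivative of \<open>?q\<close> is the remainder \<open>?r\<close> just
    bounded, as that of \<open>?r\<close> was \<open>F 2 t - F 2 a\<close>.\<close>
  let ?q = "\<lambda>x. F 0 x - (F 0 a + F 1 a * (x - a) + F 2 a / 2 * (x - a)\<^sup>2)"
  have F0: "\<bar>?q x - ?q a\<bar> \<le> K * \<bar>x - a\<bar> ^ Suc (Suc (Suc 0))" if "x \<in> D" "\<bar>x - a\<bar> < \<eta>" for x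
  proof (rule deviation_le_power[OF assms(2,3) that(1) _ _ K(1)])
    show "(?q has_real_derivative ?r t) (at t within D)" if "t \<in> D" for t
      using deriv[OF that, of 0] by (auto intro!: derivative_eq_intros)
    show "\<bar>?r t\<bar> \<le> K * \<bar>t - a\<bar> ^ Suc (Suc 0)" if "t \<in> closed_segment a x" for t
      using F1[of t] sub[OF that] \<open>x \<in> D\<close> \<open>\<bar>x - a\<bar> < \<eta>\<close> by simp
  qed
  have "F 0 = f" by (simp add: F_def caputo_iter_def)
  then show thesis
    using F1 F0 by (intro that[OF K(2), of K]) (simp_all add: numeral_2_eq_2 numeral_3_eq_3)
qed

text \<open>Start from a bound on \<open>F 3\<close> near \<open>a\<close> and integrate three times
  with \<open>caputo_expansion\<close>; the remainder has order \<open>\<alpha>\<close> for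
  \<open>F 2\<close>, \<open>2 * \<alpha>\<close> for \<open>F 1\<close> and
  \<open>3 * \<alpha>\<close> for \<open>f\<close>.\<close>

lemma caputo_taylor_less_1:
  fixes f :: "real \<Rightarrow> real" and a \<alpha> :: real and D :: "real set"
  defines "F \<equiv> \<lambda>j. caputo_iter D a \<alpha> j f"
  assumes "is_interval D" "a \<in> D" "has_caputo_derivs D a \<alpha> f" "0 < \<alpha>" "\<alpha> < 1"
    and "continuous_on D f"
  obtains K \<eta> where "\<eta> > 0"
    "\<And>x. x \<in> D \<Longrightarrow> a \<le> x \<Longrightarrow> x - a < \<eta> \<Longrightarrow>
       \<bar>F 1 x - (F 1 a + F 2 a / Gamma (\<alpha> + 1) * (x - a) powr \<alpha>)\<bar> \<le> K * (x - a) powr (2 * \<alpha>)"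
    "\<And>x. x \<in> D \<Longrightarrow> a \<le> x \<Longrightarrow> x - a < \<eta> \<Longrightarrow>
       \<bar>f x - (f a + F 1 a / Gamma (\<alpha> + 1) * (x - a) powr \<alpha>
          + F 2 a / Gamma (2 * \<alpha> + 1) * (x - a) powr (2 * \<alpha>))\<bar> \<le> K * (x - a) powr (3 * \<alpha>)"
proof -
  have pos: "Gamma (\<alpha> + 1) > 0" "Gamma (2 * \<alpha> + 1) > 0" "Gamma (3 * \<alpha> + 1) > 0"
    using assms(5) by simp_all
  have F0: "F 0 = f" by (simp add: F_def caputo_iter_def)
  have dom: "caputo_dom D a \<alpha> = D \<inter> {a..}"
    using assms(6) by (simp add: caputo_dom_def)
  have cont: "continuous_on (D \<inter> {a..}) (F j)" for j
  proof (cases j)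
    case 0
    then show ?thesis using assms(7) by (auto simp: F0 intro: continuous_on_subset)
  next
    case (Suc i)
    then show ?thesis using has_caputo_derivsD(2)[OF assms(4), of i] by (simp add: F_def dom)
  qed
  have diff: "caputo_differentiable D a \<alpha> (F j)" for j
    unfolding F_def by (rule has_caputo_derivsD(1)[OF assms(4)])
  obtain K \<eta> where K: "K \<ge> 0" "\<eta> > 0" "\<And>x. x \<in> D \<inter> {a..} \<Longrightarrow> \<bar>x - a\<bar> < \<eta> \<Longrightarrow> \<bar>F 3 x\<bar> \<le> K"
    using continuous_on_locally_bounded[OF cont[of 3], of a] assms(3) by auto
  have sub: "t \<in> D" if "t \<in> {a..x}" "x \<in> D" for t x
    using that assms(2,3) by (meson atLeastAtMost_iff mem_is_interval_1_I)
  \<comment> \<open>The case \<open>x = a\<close>, excluded in \<open>caputo_expansion\<close>,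
    holds because both sides vanish there.\<close>
  have step: "\<bar>F j x - F j a - (p / Gamma (\<alpha> + 1) * (x - a) powr \<alpha>
      + q * Gamma (\<alpha> + 1) / Gamma (2 * \<alpha> + 1) * (x - a) powr (2 * \<alpha>))\<bar>
      \<le> B * Gamma (\<beta> + 1) / Gamma (\<alpha> + \<beta> + 1) * (x - a) powr (\<alpha> + \<beta>)"
    if "x \<in> D" "a \<le> x" "x - a < \<eta>" "\<beta> \<ge> 0"
      and "\<And>t. t \<in> D \<Longrightarrow> a \<le> t \<Longrightarrow> t - a < \<eta> \<Longrightarrow> 
        \<bar>F (Suc j) t - (p + q * (t - a) powr \<alpha>)\<bar> \<le> B * (t - a) powr \<beta>" for j x p q B \<beta>
  proof (cases "x = a")
    case False
    then show ?thesis
      using that sub[OF _ that(1)]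
      by (intro caputo_expansion[OF assms(2,3) that(1) _ assms(5,6) cont diff that(4)])
        (auto simp: F_def caputo_iter_Suc)
  qed simp
  define B where "B = K / Gamma (\<alpha> + 1)"
  have F2: "\<bar>F 2 x - F 2 a\<bar> \<le> B * (x - a) powr \<alpha>"
    if "x \<in> D" "a \<le> x" "x - a < \<eta>" for x
  proof (cases "x = a")
    case False
    \<comment> \<open>\<open>step\<close> does not apply with \<open>\<beta> = 0\<close>, since \<open>0 powr 0 = 0\<close> at \<open>t = a\<close>.\<close>
    show ?thesis
      using caputo_expansion[OF assms(2,3) that(1) _ assms(5,6) cont[of 2] diff[of 2], of 0 0 0 K]
        that sub[OF _ that(1)] False K(3)
      by (auto simp: B_def F_def caputo_iter_Suc numeral_3_eq_3 numeral_2_eq_2)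
  qed simp
  define L where "L = B * Gamma (\<alpha> + 1) / Gamma (2 * \<alpha> + 1)"
  have F1: "\<bar>F 1 x - (F 1 a + F 2 a / Gamma (\<alpha> + 1) * (x - a) powr \<alpha>)\<bar> \<le> L * (x - a) powr (2 * \<alpha>)"
    if "x \<in> D" "a \<le> x" "x - a < \<eta>" for x
    using step[OF that, of \<alpha> 1 "F 2 a" 0 B] F2 assms(5)
    by (simp add: L_def numeral_2_eq_2[symmetric] diff_diff_eq mult_2[symmetric])
  define M where "M = L * Gamma (2 * \<alpha> + 1) / Gamma (3 * \<alpha> + 1)"
  have eq: "\<alpha> + 2 * \<alpha> = 3 * \<alpha>" by simp
  \<comment> \<open>The coefficient \<open>Gamma (\<alpha> + 1)\<close> produced by integrating the
    linear term cancels against the denominator under \<open>F 2 a\<close> in the expansion of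
    \<open>F 1\<close>.\<close>
  have F0: "\<bar>f x - (f a + F 1 a / Gamma (\<alpha> + 1) * (x - a) powr \<alpha>
          + F 2 a / Gamma (2 * \<alpha> + 1) * (x - a) powr (2 * \<alpha>))\<bar> \<le> M * (x - a) powr (3 * \<alpha>)"
    if "x \<in> D" "a \<le> x" "x - a < \<eta>" for x
    using step[OF that, of "2 * \<alpha>" 0 "F 1 a" "F 2 a / Gamma (\<alpha> + 1)" L] F1 assms(5) pos
    by (simp add: M_def F0 diff_diff_eq add.assoc eq)
  show thesis
  proof (rule that[OF K(2), of "max L M"])
    fix x assume x: "x \<in> D" "a \<le> x" "x - a < \<eta>"
    show "\<bar>F 1 x - (F 1 a + F 2 a / Gamma (\<alpha> + 1) * (x - a) powr \<alpha>)\<bar>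
        \<le> max L M * (x - a) powr (2 * \<alpha>)"
      using F1[OF x] by (rule order_trans) (intro mult_right_mono, auto)
    show "\<bar>f x - (f a + F 1 a / Gamma (\<alpha> + 1) * (x - a) powr \<alpha>
        + F 2 a / Gamma (2 * \<alpha> + 1) * (x - a) powr (2 * \<alpha>))\<bar> \<le> max L M * (x - a) powr (3 * \<alpha>)"
      using F0[OF x] by (rule order_trans) (intro mult_right_mono, auto)
  qed
qed

text \<open>In the variable \<open>s\<close> both cases become polynomial expansions of the same
  form: for order 1, \<open>s\<close> is \<open>x - a\<close> with its sign and the Gamma values are
  1 and 2. Later arguments need not distinguish them.\<close>

lemma caputo_taylor:
  fixes f :: "real \<Rightarrow> real"
  assumes "is_interval D" "a \<in> D" "has_caputo_derivs D a \<alpha> f" "0 < \<alpha>" "\<alpha> \<le> 1"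
    and "continuous_on D f"
  obtains K \<eta> where "\<eta> > 0"
    "\<And>x s. x \<in> caputo_dom D a \<alpha> \<Longrightarrow> \<bar>x - a\<bar> < \<eta> \<Longrightarrow> s = rpow (x - a) \<alpha> \<Longrightarrow>
       \<bar>caputo_iter D a \<alpha> 1 f x
          - (caputo_iter D a \<alpha> 1 f a + caputo_iter D a \<alpha> 2 f a / Gamma (\<alpha> + 1) * s)\<bar> \<le> K * \<bar>s\<bar>\<^sup>2"
    "\<And>x s. x \<in> caputo_dom D a \<alpha> \<Longrightarrow> \<bar>x - a\<bar> < \<eta> \<Longrightarrow> s = rpow (x - a) \<alpha> \<Longrightarrow>
       \<bar>f x - (f a + caputo_iter D a \<alpha> 1 f a / Gamma (\<alpha> + 1) * s
          + caputo_iter D a \<alpha> 2 f a / Gamma (2 * \<alpha> + 1) * s\<^sup>2)\<bar> \<le> K * \<bar>s\<bar> ^ 3"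
proof (cases "\<alpha> = 1")
  case True
  have \<Gamma>: "Gamma 2 = (1::real)" "Gamma 3 = (2::real)"
    using Gamma_fact[of 1, where 'a = real] Gamma_fact[of 2, where 'a = real] by simp_all
  show thesis
  proof (rule caputo_taylor_1[OF assms(1,2) assms(3)[unfolded True]])
    fix K \<eta>
    assume "\<eta> > 0"
      "\<And>x. x \<in> D \<Longrightarrow> \<bar>x - a\<bar> < \<eta> \<Longrightarrow> \<bar>caputo_iter D a 1 1 f x
         - (caputo_iter D a 1 1 f a + caputo_iter D a 1 2 f a * (x - a))\<bar> \<le> K * \<bar>x - a\<bar>\<^sup>2"
      "\<And>x. x \<in> D \<Longrightarrow> \<bar>x - a\<bar> < \<eta> \<Longrightarrow> \<bar>f x - (f a + caputo_iter D a 1 1 f a * (x - a)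
         + caputo_iter D a 1 2 f a / 2 * (x - a)\<^sup>2)\<bar> \<le> K * \<bar>x - a\<bar> ^ 3"
    then show thesis
      by (intro that[of \<eta> K]) (simp_all add: caputo_dom_def True \<Gamma>)
  qed
next
  case False
  then have \<alpha>: "\<alpha> < 1" using assms(5) by simp
  obtain K \<eta> where *: "\<eta> > 0"
    "\<And>x. x \<in> D \<Longrightarrow> a \<le> x \<Longrightarrow> x - a < \<eta> \<Longrightarrow>
       \<bar>caputo_iter D a \<alpha> 1 f x - (caputo_iter D a \<alpha> 1 f a
         + caputo_iter D a \<alpha> 2 f a / Gamma (\<alpha> + 1) * (x - a) powr \<alpha>)\<bar> \<le> K * (x - a) powr (2 * \<alpha>)"
    "\<And>x. x \<in> D \<Longrightarrow> a \<le> x \<Longrightarrow> x - a < \<eta> \<Longrightarrow>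
       \<bar>f x - (f a + caputo_iter D a \<alpha> 1 f a / Gamma (\<alpha> + 1) * (x - a) powr \<alpha>
          + caputo_iter D a \<alpha> 2 f a / Gamma (2 * \<alpha> + 1) * (x - a) powr (2 * \<alpha>))\<bar>
       \<le> K * (x - a) powr (3 * \<alpha>)"
    using caputo_taylor_less_1[OF assms(1-4) \<alpha> assms(6)] by metis
  have pw: "y powr (2 * \<alpha>) = (y powr \<alpha>)\<^sup>2" "y powr (3 * \<alpha>) = (y powr \<alpha>) ^ 3" for y :: real
    by (simp_all add: powr_powr[symmetric] powr_power mult.commute)
  show thesis
    using *(2,3) assms(4) False
    by (intro that[OF *(1), of K]) (auto simp: caputo_dom_def rpow_nonneg_base pw)
qed

section \<open>The sign of the error coefficient and the expansion of one Newton step\<close>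

lemma Gamma_sq_less:
  fixes \<alpha> :: real
  assumes "\<alpha> > 0"
  shows "(Gamma (\<alpha> + 1))\<^sup>2 < Gamma (2 * \<alpha> + 1)"
proof -
  \<comment> \<open>The logarithm of the quotient of the two sides vanishes at 0 and increases,
    because Digamma is strictly increasing.\<close>
  let ?\<phi> = "\<lambda>t::real. ln_Gamma (2 * t + 1) - 2 * ln_Gamma (t + 1)"
  have deriv: "(?\<phi> has_real_derivative 2 * (Digamma (2 * t + 1) - Digamma (t + 1))) (at t)"
    if "t \<ge> 0" for t
    using that by (auto intro!: derivative_eq_intros)
  have "?\<phi> 0 < ?\<phi> \<alpha>"
  proof (rule DERIV_pos_imp_increasing_open[OF assms])
    show "\<exists>y. (?\<phi> has_real_derivative y) (at t) \<and> y > 0" if "0 < t" "t < \<alpha>" for t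
      using deriv[of t] Digamma_real_strict_mono[of "t + 1" "2 * t + 1"] that by force
    show "continuous_on {0..\<alpha>} ?\<phi>"
      by (intro continuous_at_imp_continuous_on ballI, rule DERIV_isCont, rule deriv) simp
  qed
  moreover have "ln_Gamma (1::real) = 0"
    using Gamma_real_pos_exp[of 1] by simp
  ultimately have "exp (2 * ln_Gamma (\<alpha> + 1)) < exp (ln_Gamma (2 * \<alpha> + 1))"
    by simp
  then show ?thesis
    using assms by (simp add: exp_double Gamma_real_pos_exp)
qed

text \<open>For \<open>\<bar>v\<bar> \<le> 1 / 2\<close> the base \<open>1 + v\<close> stays away
  from 0, so the second derivative is bounded by compactness. Both \<open>?u\<close> and its
  derivative \<open>?r\<close> vanish at 0, and two uses of \<open>deviation_le_power\<close> give
  the quadratic remainder.\<close>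

lemma powr_expansion:
  fixes q :: real
  obtains L where "L \<ge> 0" "\<And>v. \<bar>v\<bar> \<le> 1 / 2 \<Longrightarrow> \<bar>(1 + v) powr q - (1 + q * v)\<bar> \<le> L * v\<^sup>2"
proof -
  let ?S = "{- 1 / 2..1 / 2} :: real set"
  let ?r = "\<lambda>v. q * (1 + v) powr (q - 1) - q"
  let ?u = "\<lambda>v. (1 + v) powr q - (1 + q * v)"
  let ?r' = "\<lambda>v. q * (q - 1) * (1 + v) powr (q - 2)"
  have "compact (?r' ` ?S)"
    by (intro compact_continuous_image continuous_intros) auto
  then obtain L where L: "L > 0" "\<And>v. v \<in> ?S \<Longrightarrow> \<bar>?r' v\<bar> \<le> L"
    by (force dest!: compact_imp_bounded simp: bounded_pos)
  have seg: "t \<in> ?S" if "t \<in> closed_segment 0 v" "v \<in> ?S" for t v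
    using that closed_segment_dist_less[of t 0 v] by auto
  have r: "\<bar>?r v - ?r 0\<bar> \<le> L * \<bar>v - 0\<bar> ^ Suc 0" if "v \<in> ?S" for v
  proof (rule deviation_le_power[where S = ?S])
    show "(?r has_real_derivative ?r' t) (at t within ?S)" if "t \<in> ?S" for t
      using that by (auto intro!: derivative_eq_intros simp: algebra_simps)
    show "\<bar>?r' t\<bar> \<le> L * \<bar>t - 0\<bar> ^ 0" if "t \<in> closed_segment 0 v" for t
      using L(2)[OF seg[OF that \<open>v \<in> ?S\<close>]] by simp
  qed (use L that in auto)
  have u: "\<bar>?u v - ?u 0\<bar> \<le> L * \<bar>v - 0\<bar> ^ Suc (Suc 0)" if "v \<in> ?S" for v
  proof (rule deviation_le_power[where S = ?S])
    show "(?u has_real_derivative ?r t) (at t within ?S)" if "t \<in> ?S" for t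
      using that by (auto intro!: derivative_eq_intros)
    show "\<bar>?r t\<bar> \<le> L * \<bar>t - 0\<bar> ^ Suc 0" if "t \<in> closed_segment 0 v" for t
      using r[OF seg[OF that \<open>v \<in> ?S\<close>]] by simp
  qed (use L that in auto)
  show thesis
  proof (rule that[of L])
    show "\<bar>(1 + v) powr q - (1 + q * v)\<bar> \<le> L * v\<^sup>2" if "\<bar>v\<bar> \<le> 1 / 2" for v
    proof -
      have "v \<in> ?S" using that by (auto simp: abs_le_iff)
      from u[OF this] show ?thesis by (simp add: power2_eq_square)
    qed
  qed (use L(1) in simp)
qed

text \<open>Up to \<open>O(s ^ 3)\<close>, \<open>A * F\<close> and \<open>g * s\<close> agree in
  their term \<open>G * s\<close>, and their terms in \<open>s\<^sup>2\<close> differ by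
  \<open>c * G * s\<^sup>2\<close>. Quantifying over the values \<open>F\<close> and
  \<open>g\<close> makes the constants uniform in the point where they are taken.\<close>

lemma newton_ratio_expansion:
  fixes G H K A B :: real
  assumes "G \<noteq> 0" "A > 0" "B > 0"
  defines "c \<equiv> H / G * (A / B - 1 / A)"
  obtains \<sigma> L where "0 < \<sigma>" "\<sigma> \<le> 1" "L \<ge> 0"
    "\<And>s F g. \<bar>s\<bar> < \<sigma> \<Longrightarrow> \<bar>F - (G / A * s + H / B * s\<^sup>2)\<bar> \<le> K * \<bar>s\<bar> ^ 3 \<Longrightarrow>
       \<bar>g - (G + H / A * s)\<bar> \<le> K * \<bar>s\<bar>\<^sup>2 \<Longrightarrow>
       g \<noteq> 0 \<and> (\<exists>v. A * (F / g) = s * (1 + v) \<and> \<bar>v - c * s\<bar> \<le> L * s\<^sup>2 \<and> \<bar>v\<bar> \<le> 1 / 2)"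
proof -
  \<comment> \<open>\<open>T * \<bar>s\<bar>\<close> bounds the deviation of \<open>g\<close> from
    \<open>G\<close>, \<open>M * \<bar>s\<bar> ^ 3\<close> bounds the numerator of
    \<open>v - c * s\<close>, and the factor 2 in \<open>L\<close> comes from
    \<open>\<bar>g\<bar> \<ge> \<bar>G\<bar> / 2\<close>.\<close>
  define T where "T = \<bar>H\<bar> / A + \<bar>K\<bar>"
  define M where "M = A * \<bar>K\<bar> + \<bar>K\<bar> + \<bar>c\<bar> * T"
  define L where "L = 2 * M / \<bar>G\<bar>"
  have T: "T \<ge> 0" using assms(2) by (simp add: T_def)
  have M: "M \<ge> 0" using assms(2) T by (simp add: M_def)
  have L: "L \<ge> 0" using M by (simp add: L_def)
  \<comment> \<open>The three entries ensure, in turn, \<open>s\<^sup>2 \<le> \<bar>s\<bar>\<close>,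
    \<open>\<bar>g\<bar> \<ge> \<bar>G\<bar> / 2\<close> and
    \<open>\<bar>v\<bar> \<le> 1 / 2\<close>.\<close>
  define \<sigma> where "\<sigma> = min 1 (min (\<bar>G\<bar> / (2 * (T + 1))) (1 / (2 * (\<bar>c\<bar> + L + 1))))"
  show thesis
  proof (rule that[of \<sigma> L])
    show "0 < \<sigma>" using assms(1) T L by (simp add: \<sigma>_def)
    show "\<sigma> \<le> 1" by (simp add: \<sigma>_def)
    fix s F g :: real
    assume s: "\<bar>s\<bar> < \<sigma>" and F: "\<bar>F - (G / A * s + H / B * s\<^sup>2)\<bar> \<le> K * \<bar>s\<bar> ^ 3"
      and g: "\<bar>g - (G + H / A * s)\<bar> \<le> K * \<bar>s\<bar>\<^sup>2"
    define \<rho> where "\<rho> = F - (G / A * s + H / B * s\<^sup>2)"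
    define \<tau> where "\<tau> = g - (G + H / A * s)"
    have "\<bar>s\<bar> \<le> 1" using s by (simp add: \<sigma>_def)
    then have s2: "s\<^sup>2 \<le> \<bar>s\<bar>"
      using mult_left_mono[of "\<bar>s\<bar>" 1 "\<bar>s\<bar>"] by (simp add: power2_eq_square)
    have \<rho>: "\<bar>\<rho>\<bar> \<le> \<bar>K\<bar> * \<bar>s\<bar> ^ 3"
      using F unfolding \<rho>_def by (rule order_trans) (intro mult_right_mono, auto)
    have \<tau>: "\<bar>\<tau>\<bar> \<le> \<bar>K\<bar> * \<bar>s\<bar>\<^sup>2"
      using g unfolding \<tau>_def by (rule order_trans) (intro mult_right_mono, auto)
    have T': "\<bar>H / A * s + \<tau>\<bar> \<le> T * \<bar>s\<bar>"
    proof -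
      have "\<bar>K\<bar> * \<bar>s\<bar>\<^sup>2 \<le> \<bar>K\<bar> * \<bar>s\<bar>"
        using s2 by (intro mult_left_mono) auto
      with \<tau> have "\<bar>\<tau>\<bar> \<le> \<bar>K\<bar> * \<bar>s\<bar>" by linarith
      moreover have "\<bar>H / A * s\<bar> = \<bar>H\<bar> / A * \<bar>s\<bar>" using assms(2) by (simp add: abs_mult)
      ultimately show ?thesis
        by (simp only: T_def distrib_right) linarith
    qed
    have "T * \<bar>s\<bar> \<le> \<bar>G\<bar> / 2"
    proof -
      have "\<bar>s\<bar> \<le> \<bar>G\<bar> / (2 * (T + 1))" using s by (simp add: \<sigma>_def)
      then have "(T + 1) * \<bar>s\<bar> \<le> \<bar>G\<bar> / 2" using T by (simp add: field_simps)
      then show ?thesis by (simp add: distrib_right)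
    qed
    then have g2: "\<bar>g\<bar> \<ge> \<bar>G\<bar> / 2"
      using T' by (simp add: \<tau>_def)
    then have g0: "g \<noteq> 0" using assms(1) by auto
    show "g \<noteq> 0 \<and> (\<exists>v. A * (F / g) = s * (1 + v) \<and> \<bar>v - c * s\<bar> \<le> L * s\<^sup>2 \<and> \<bar>v\<bar> \<le> 1 / 2)"
    proof (cases "s = 0")
      case True
      then have "F = 0" using \<rho> by (simp add: \<rho>_def)
      then show ?thesis using True g0 by (intro conjI exI[of _ 0]) auto
    next
      case False
      define v where "v = A * F / (g * s) - 1"
      \<comment> \<open>After clearing the denominator, the choice of \<open>c\<close> cancels the
        terms in \<open>s\<^sup>2\<close>; each remaining term is of third order.\<close>
      have num: "(v - c * s) * (g * s) = A * \<rho> - \<tau> * s - c * s\<^sup>2 * (H / A * s + \<tau>)"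
      proof -
        have cG: "c * G = H * A / B - H / A"
          using assms(1) by (simp add: c_def field_simps)
        have "(v - c * s) * (g * s) = A * F - g * s - c * s\<^sup>2 * g"
          using False g0 by (simp add: v_def field_simps power2_eq_square)
        also have "\<dots> = A * F - g * s - c * G * s\<^sup>2 - c * s\<^sup>2 * (H / A * s + \<tau>)"
          by (simp add: \<tau>_def algebra_simps)
        also have "A * F - g * s - c * G * s\<^sup>2 = A * \<rho> - \<tau> * s"
          unfolding cG using assms(2,3) by (simp add: \<rho>_def \<tau>_def field_simps power2_eq_square)
        finally show ?thesis .
      qed
      have "\<bar>v - c * s\<bar> * (\<bar>g\<bar> * \<bar>s\<bar>) \<le> M * \<bar>s\<bar> ^ 3"
      proof -
        have "\<bar>A * \<rho>\<bar> \<le> A * \<bar>K\<bar> * \<bar>s\<bar> ^ 3"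
          using \<rho> assms(2) by (simp add: abs_mult mult.assoc)
        moreover have "\<bar>\<tau> * s\<bar> \<le> \<bar>K\<bar> * \<bar>s\<bar> ^ 3"
          using mult_right_mono[OF \<tau>, of "\<bar>s\<bar>"]
          by (simp add: abs_mult power3_eq_cube power2_eq_square mult.assoc)
        moreover have "\<bar>c * s\<^sup>2 * (H / A * s + \<tau>)\<bar> \<le> \<bar>c\<bar> * T * \<bar>s\<bar> ^ 3"
        proof -
          have "\<bar>c * s\<^sup>2 * (H / A * s + \<tau>)\<bar> = (\<bar>c\<bar> * \<bar>s\<bar>\<^sup>2) * \<bar>H / A * s + \<tau>\<bar>"
            by (simp only: abs_mult power_abs)
          also have "\<dots> \<le> (\<bar>c\<bar> * \<bar>s\<bar>\<^sup>2) * (T * \<bar>s\<bar>)"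
            using T' by (intro mult_left_mono) auto
          finally show ?thesis by (simp add: power3_eq_cube power2_eq_square mult_ac)
        qed
        ultimately have "\<bar>(v - c * s) * (g * s)\<bar> \<le> M * \<bar>s\<bar> ^ 3"
          unfolding num M_def distrib_right by linarith
        then show ?thesis by (simp add: abs_mult)
      qed
      moreover have "\<bar>v - c * s\<bar> * (\<bar>G\<bar> / 2 * \<bar>s\<bar>) \<le> \<bar>v - c * s\<bar> * (\<bar>g\<bar> * \<bar>s\<bar>)"
        using g2 by (intro mult_left_mono mult_right_mono) auto
      ultimately have "\<bar>v - c * s\<bar> * (\<bar>G\<bar> / 2 * \<bar>s\<bar>) \<le> M * \<bar>s\<bar> ^ 3"
        by linarith
      then have vc: "\<bar>v - c * s\<bar> \<le> L * s\<^sup>2"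
        using False assms(1) by (simp add: L_def field_simps power3_eq_cube power2_eq_square)
      have "\<bar>v\<bar> \<le> \<bar>c\<bar> * \<bar>s\<bar> + L * \<bar>s\<bar>"
      proof -
        have "L * s\<^sup>2 \<le> L * \<bar>s\<bar>" using L s2 by (intro mult_left_mono) auto
        with vc have "\<bar>v - c * s\<bar> \<le> L * \<bar>s\<bar>" by linarith
        then show ?thesis unfolding abs_mult[symmetric] by linarith
      qed
      also have "\<dots> \<le> (\<bar>c\<bar> + L + 1) * \<bar>s\<bar>" by (simp add: distrib_right)
      also have "\<dots> \<le> 1 / 2"
      proof -
        have "\<bar>s\<bar> \<le> 1 / (2 * (\<bar>c\<bar> + L + 1))" using s by (simp add: \<sigma>_def)
        then show ?thesis using L by (simp add: field_simps)
      qed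
      finally have "\<bar>v\<bar> \<le> 1 / 2" .
      moreover have "A * (F / g) = s * (1 + v)"
        using False g0 by (simp add: v_def field_simps)
      ultimately show ?thesis using g0 vc by blast
    qed
  qed (rule L)
qed

lemma newton_step_expansion:
  fixes f :: "real \<Rightarrow> real" and D :: "real set" and a \<alpha> :: real
  assumes "is_interval D" "a \<in> D" "f a = 0" "continuous_on D f" "0 < \<alpha>" "\<alpha> \<le> 1"
    and "has_caputo_derivs D a \<alpha> f" "caputo_iter D a \<alpha> 1 f a \<noteq> 0"
  defines "A \<equiv> (Gamma (2 * \<alpha> + 1) - (Gamma (\<alpha> + 1))\<^sup>2) / (\<alpha> * (Gamma (\<alpha> + 1))\<^sup>2) * C2 D a \<alpha> f"
  obtains \<delta> N where "\<delta> > 0" "N \<ge> 0"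
    "\<And>x. x \<in> caputo_dom D a \<alpha> \<Longrightarrow> \<bar>x - a\<bar> < \<delta> \<Longrightarrow>
       caputo_iter D a \<alpha> 1 f x \<noteq> 0 \<and> (\<alpha> < 1 \<longrightarrow> 0 \<le> newton_radicand D a \<alpha> f x) \<and>
       \<bar>newton_step D a \<alpha> f x - a - A * rpow (x - a) (\<alpha> + 1)\<bar> \<le> N * \<bar>x - a\<bar> powr (2 * \<alpha> + 1)"
proof -
  define G where "G = caputo_iter D a \<alpha> 1 f a"
  define H where "H = caputo_iter D a \<alpha> 2 f a"
  define P where "P = Gamma (\<alpha> + 1)"
  define Q where "Q = Gamma (2 * \<alpha> + 1)"
  have G: "G \<noteq> 0" using assms(8) by (simp add: G_def)
  have PQ: "P > 0" "Q > 0" using assms(5) by (simp_all add: P_def Q_def)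
  obtain K \<eta> where \<eta>: "\<eta> > 0"
    and taylor: "\<And>x s. x \<in> caputo_dom D a \<alpha> \<Longrightarrow> \<bar>x - a\<bar> < \<eta> \<Longrightarrow> s = rpow (x - a) \<alpha> \<Longrightarrow>
       \<bar>caputo_iter D a \<alpha> 1 f x - (G + H / P * s)\<bar> \<le> K * \<bar>s\<bar>\<^sup>2"
    "\<And>x s. x \<in> caputo_dom D a \<alpha> \<Longrightarrow> \<bar>x - a\<bar> < \<eta> \<Longrightarrow> s = rpow (x - a) \<alpha> \<Longrightarrow>
       \<bar>f x - (G / P * s + H / Q * s\<^sup>2)\<bar> \<le> K * \<bar>s\<bar> ^ 3"
    using caputo_taylor[OF assms(1,2,7,5,6,4)] assms(3)
    unfolding G_def H_def P_def Q_def by (metis add_0)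
  define c where "c = H / G * (P / Q - 1 / P)"
  obtain \<sigma> L where \<sigma>: "0 < \<sigma>" "\<sigma> \<le> 1" and L: "L \<ge> 0"
    and ratio: "\<And>s F g. \<bar>s\<bar> < \<sigma> \<Longrightarrow> \<bar>F - (G / P * s + H / Q * s\<^sup>2)\<bar> \<le> K * \<bar>s\<bar> ^ 3 \<Longrightarrow>
       \<bar>g - (G + H / P * s)\<bar> \<le> K * \<bar>s\<bar>\<^sup>2 \<Longrightarrow>
       g \<noteq> 0 \<and> (\<exists>v. P * (F / g) = s * (1 + v) \<and> \<bar>v - c * s\<bar> \<le> L * s\<^sup>2 \<and> \<bar>v\<bar> \<le> 1 / 2)"
    using newton_ratio_expansion[OF G PQ] unfolding c_def by metis
  define q where "q = 1 / \<alpha>"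
  have q: "q > 0" using assms(5) by (simp add: q_def)
  obtain L' where L': "L' \<ge> 0" "\<And>v. \<bar>v\<bar> \<le> 1 / 2 \<Longrightarrow> \<bar>(1 + v) powr q - (1 + q * v)\<bar> \<le> L' * v\<^sup>2"
    using powr_expansion by metis
  \<comment> \<open>Here \<open>C2\<close> contributes \<open>P / Q * (H / G)\<close>, and
    \<open>(Q - P\<^sup>2) / P\<^sup>2 * (P / Q)\<close> equals
    \<open>1 / P - P / Q\<close>.\<close>
  have A: "A = - q * c"
    unfolding A_def C2_def c_def q_def G_def[symmetric] H_def[symmetric] P_def[symmetric]
      Q_def[symmetric]
    using G PQ assms(5) by (simp add: field_simps power2_eq_square)
  \<comment> \<open>The first summand pays for replacing \<open>v\<close> by \<open>c * s\<close> in
    the linear term, the second for the quadratic remainder of the power, with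
    \<open>\<bar>v\<bar> \<le> (\<bar>c\<bar> + L) * \<bar>s\<bar>\<close>.\<close>
  define N where "N = q * L + L' * (\<bar>c\<bar> + L)\<^sup>2"
  show thesis
  proof (rule that[of "min \<eta> (\<sigma> powr q)" N])
    show "min \<eta> (\<sigma> powr q) > 0" using \<eta> \<sigma> by simp
    show "N \<ge> 0" using q L L' by (simp add: N_def)
    fix x assume dom: "x \<in> caputo_dom D a \<alpha>" and near: "\<bar>x - a\<bar> < min \<eta> (\<sigma> powr q)"
    define e where "e = x - a"
    define s where "s = rpow e \<alpha>"
    have cases: "\<alpha> = 1 \<and> s = e \<or> \<alpha> < 1 \<and> e \<ge> 0 \<and> s = e powr \<alpha>"
    proof (cases "\<alpha> = 1")
      case False
      then have "e \<ge> 0" using dom by (simp add: e_def caputo_dom_def)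
      then show ?thesis using False assms(5,6) by (simp add: s_def rpow_nonneg_base)
    qed (simp add: s_def)
    have abs_s: "\<bar>s\<bar> = \<bar>e\<bar> powr \<alpha>"
      using cases by auto
    have "\<bar>s\<bar> < \<sigma>"
    proof -
      have "\<bar>e\<bar> powr \<alpha> < (\<sigma> powr q) powr \<alpha>"
        using near assms(5) by (intro powr_less_mono2) (auto simp: e_def)
      also have "\<dots> = \<sigma>" using \<sigma> assms(5) by (simp add: powr_powr q_def)
      finally show ?thesis by (simp add: abs_s)
    qed
    moreover have "\<bar>x - a\<bar> < \<eta>" using near by simp
    ultimately obtain v where g: "caputo_iter D a \<alpha> 1 f x \<noteq> 0"
      and v: "P * (f x / caputo_iter D a \<alpha> 1 f x) = s * (1 + v)"
        "\<bar>v - c * s\<bar> \<le> L * s\<^sup>2" "\<bar>v\<bar> \<le> 1 / 2"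
      using ratio[of s "f x" "caputo_iter D a \<alpha> 1 f x"] taylor[OF dom, of s]
      by (auto simp: s_def e_def)
    have rad: "newton_radicand D a \<alpha> f x = s * (1 + v)"
      using v(1) by (simp add: newton_radicand_def P_def)
    have v_pos: "1 + v > 0" using v(3) by linarith
    \<comment> \<open>For order 1 the exponent is 1 and \<open>e\<close> may be negative; below 1
      the base is nonnegative, so \<open>powr\<close> laws apply even when \<open>q\<close> is a
      natural number.\<close>
    have "rpow (s * (1 + v)) q = e * (1 + v) powr q"
      using cases
    proof
      assume "\<alpha> = 1 \<and> s = e"
      then show ?thesis using v_pos by (simp add: q_def)
    next
      assume *: "\<alpha> < 1 \<and> e \<ge> 0 \<and> s = e powr \<alpha>"
      then have "rpow (s * (1 + v)) q = (s * (1 + v)) powr q"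
        using v_pos q by (intro rpow_nonneg_base) auto
      also have "\<dots> = e * (1 + v) powr q"
        using * v_pos assms(5) by (simp add: powr_mult powr_powr q_def)
      finally show ?thesis .
    qed
    then have step: "newton_step D a \<alpha> f x - a = e - e * (1 + v) powr q"
      by (simp add: newton_step_def rad e_def flip: q_def)
    have pw: "rpow e (\<alpha> + 1) = e * s"
      using cases
    proof
      assume "\<alpha> = 1 \<and> s = e"
      then show ?thesis by (simp add: rpow_def power2_eq_square)
    next
      assume *: "\<alpha> < 1 \<and> e \<ge> 0 \<and> s = e powr \<alpha>"
      then show ?thesis using assms(5) by (simp add: rpow_nonneg_base powr_add)
    qed
    have pw': "\<bar>e\<bar> powr (2 * \<alpha> + 1) = \<bar>e\<bar> * s\<^sup>2"
    proof -
      have "s\<^sup>2 = \<bar>e\<bar> powr \<alpha> * \<bar>e\<bar> powr \<alpha>"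
        unfolding abs_s[symmetric] by (simp add: power2_eq_square)
      then show ?thesis unfolding mult_2 powr_add by simp
    qed
    have "\<bar>s\<bar> \<le> 1" using \<open>\<bar>s\<bar> < \<sigma>\<close> \<sigma> by simp
    then have s2: "s\<^sup>2 \<le> \<bar>s\<bar>"
      using mult_left_mono[of "\<bar>s\<bar>" 1 "\<bar>s\<bar>"] by (simp add: power2_eq_square)
    have "\<bar>v\<bar> \<le> (\<bar>c\<bar> + L) * \<bar>s\<bar>"
    proof -
      have "L * s\<^sup>2 \<le> L * \<bar>s\<bar>" using L s2 by (intro mult_left_mono) auto
      with v(2) show ?thesis unfolding distrib_right abs_mult[symmetric] by linarith
    qed
    then have "v\<^sup>2 \<le> ((\<bar>c\<bar> + L) * \<bar>s\<bar>)\<^sup>2"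
      using L by (intro abs_le_square_iff[THEN iffD1]) (simp add: abs_mult)
    then have "L' * v\<^sup>2 \<le> L' * ((\<bar>c\<bar> + L)\<^sup>2 * s\<^sup>2)"
      using L'(1) by (intro mult_left_mono) (simp_all add: power_mult_distrib)
    with L'(2)[OF v(3)] have pe: "\<bar>(1 + v) powr q - (1 + q * v)\<bar> \<le> L' * (\<bar>c\<bar> + L)\<^sup>2 * s\<^sup>2"
      by (simp add: mult.assoc)
    have "\<bar>q * (v - c * s)\<bar> \<le> q * L * s\<^sup>2"
      using v(2) q by (simp add: abs_mult mult.assoc)
    with pe have "\<bar>q * (v - c * s) + ((1 + v) powr q - (1 + q * v))\<bar> \<le> N * s\<^sup>2"
      unfolding N_def distrib_right by linarith
    then have "\<bar>e\<bar> * \<bar>q * (v - c * s) + ((1 + v) powr q - (1 + q * v))\<bar> \<le> \<bar>e\<bar> * (N * s\<^sup>2)"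
      by (intro mult_left_mono) auto
    moreover have "newton_step D a \<alpha> f x - a - A * rpow (x - a) (\<alpha> + 1)
      = - e * (q * (v - c * s) + ((1 + v) powr q - (1 + q * v)))"
      unfolding e_def[symmetric] pw step A by (simp add: algebra_simps)
    ultimately have "\<bar>newton_step D a \<alpha> f x - a - A * rpow (x - a) (\<alpha> + 1)\<bar>
        \<le> N * \<bar>x - a\<bar> powr (2 * \<alpha> + 1)"
      unfolding e_def[symmetric] pw' by (simp only: abs_mult abs_minus_cancel mult_ac)
    moreover have "0 \<le> newton_radicand D a \<alpha> f x" if "\<alpha> < 1"
      using cases that v_pos by (auto simp: rad)
    ultimately show "caputo_iter D a \<alpha> 1 f x \<noteq> 0 \<and> (\<alpha> < 1 \<longrightarrow> 0 \<le> newton_radicand D a \<alpha> f x) \<and>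
       \<bar>newton_step D a \<alpha> f x - a - A * rpow (x - a) (\<alpha> + 1)\<bar> \<le> N * \<bar>x - a\<bar> powr (2 * \<alpha> + 1)"
      using g by blast
  qed
qed

section \<open>From one step to the whole run: convergence, its order and staying in the
  domain\<close>

lemma conv_order_at_leastI:
  assumes "\<And>k. \<bar>x (Suc k) - L\<bar> \<le> M * \<bar>x k - L\<bar> powr p"
    and "\<And>k. \<bar>x (Suc k) - L\<bar> \<le> \<bar>x k - L\<bar> / 2"
  shows "conv_order_at_least x L p"
  unfolding conv_order_at_least_def
proof
  \<comment> \<open>The power bound alone does not force convergence; halving the error does, by
    comparison with a geometric sequence.\<close>
  have bound: "\<bar>x k - L\<bar> \<le> \<bar>x 0 - L\<bar> * (1 / 2) ^ k" for k
  proof (induction k)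
    case (Suc k)
    then show ?case using assms(2)[of k] by simp
  qed simp
  have "(\<lambda>k. x k - L) \<longlonglongrightarrow> 0"
  proof (rule Lim_null_comparison)
    show "\<forall>\<^sub>F k in sequentially. norm (x k - L) \<le> \<bar>x 0 - L\<bar> * (1 / 2) ^ k"
      using bound by simp
    show "(\<lambda>k. \<bar>x 0 - L\<bar> * (1 / 2) ^ k) \<longlonglongrightarrow> 0"
      by (intro tendsto_mult_right_zero LIMSEQ_power_zero) simp
  qed
  then show "x \<longlonglongrightarrow> L" by (simp add: LIM_zero_iff)
  show "(\<lambda>k. x (Suc k) - L) \<in> O(\<lambda>k. \<bar>x k - L\<bar> powr p)"
    using assms(1) by (intro bigoI[of _ M]) simp
qed

theorem theorem3:
  fixes f :: "real \<Rightarrow> real" and D :: "real set" and xbar \<alpha> :: real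
  assumes "is_interval D" and "xbar \<in> D" and "f xbar = 0"
    and "continuous_on D f"
    and "0 < \<alpha>" and "\<alpha> \<le> 1"
    and "has_caputo_derivs D xbar \<alpha> f"
    and "continuous (at xbar within caputo_dom D xbar \<alpha>) (caputo_iter D xbar \<alpha> 1 f)"
    and "caputo_iter D xbar \<alpha> 1 f xbar \<noteq> 0"
  shows "\<exists>\<delta> > 0. \<exists>M N. \<forall>x :: nat \<Rightarrow> real.
    newton_run D xbar \<alpha> f x \<and> \<bar>x 0 - xbar\<bar> < \<delta> \<longrightarrow>
      (\<forall>k. (\<forall>i\<le>k. x i \<in> caputo_dom D xbar \<alpha>) \<longrightarrow>
         caputo_iter D xbar \<alpha> 1 f (x k) \<noteq> 0 \<and>
         (\<alpha> < 1 \<longrightarrow> 0 \<le> newton_radicand D xbar \<alpha> f (x k)) \<and>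
         \<bar>x (Suc k) - xbar\<bar> \<le> M * \<bar>x k - xbar\<bar> powr (\<alpha> + 1) \<and>
         \<bar>(x (Suc k) - xbar) -
            (Gamma (2 * \<alpha> + 1) - (Gamma (\<alpha> + 1))\<^sup>2) / (\<alpha> * (Gamma (\<alpha> + 1))\<^sup>2)
              * C2 D xbar \<alpha> f * rpow (x k - xbar) (\<alpha> + 1)\<bar>
           \<le> N * \<bar>x k - xbar\<bar> powr (2 * \<alpha> + 1)) \<and>
      ((\<forall>k. x k \<in> caputo_dom D xbar \<alpha>) \<longrightarrow> conv_order_at_least x xbar (\<alpha> + 1)) \<and>
      ((\<alpha> = 1 \<and> xbar \<in> interior D) \<or> (\<alpha> < 1 \<and> C2 D xbar \<alpha> f > 0) \<longrightarrow>
         (\<forall>k. x k \<in> caputo_dom D xbar \<alpha>))"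
proof -
  let ?X = "caputo_dom D xbar \<alpha>" and ?g = "caputo_iter D xbar \<alpha> 1 f"
  define A where "A = (Gamma (2 * \<alpha> + 1) - (Gamma (\<alpha> + 1))\<^sup>2) / (\<alpha> * (Gamma (\<alpha> + 1))\<^sup>2) * C2 D xbar \<alpha> f"
  obtain \<delta>\<^sub>0 N where \<delta>0: "\<delta>\<^sub>0 > 0" and N: "N \<ge> 0"
    and expansion: "\<And>y. y \<in> ?X \<Longrightarrow> \<bar>y - xbar\<bar> < \<delta>\<^sub>0 \<Longrightarrow>
       ?g y \<noteq> 0 \<and> (\<alpha> < 1 \<longrightarrow> 0 \<le> newton_radicand D xbar \<alpha> f y) \<and>
       \<bar>newton_step D xbar \<alpha> f y - xbar - A * rpow (y - xbar) (\<alpha> + 1)\<bar>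
         \<le> N * \<bar>y - xbar\<bar> powr (2 * \<alpha> + 1)"
    using newton_step_expansion[OF assms(1-7,9)] unfolding A_def by metis
  \<comment> \<open>For errors of size at most 1 the remainder of order
    \<open>2 * \<alpha> + 1\<close> is absorbed into order \<open>\<alpha> + 1\<close>.\<close>
  define M where "M = \<bar>A\<bar> + N"
  \<comment> \<open>\<open>B\<close> is the threshold for
    \<open>\<bar>e\<bar> powr \<alpha>\<close>: the first bound makes a step halve the error, the
    second makes the leading term dominate the remainder. The case \<open>A = 0\<close> is split off
    to keep \<open>B\<close> positive.\<close>
  define B where "B = (if A = 0 then 1 / (2 * (M + 1)) else min (1 / (2 * (M + 1))) (\<bar>A\<bar> / (N + 1)))"
  have M: "M \<ge> 0" using N by (simp add: M_def)
  have B: "B > 0" using M N by (simp add: B_def)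
  obtain \<delta>\<^sub>1 where \<delta>1: "\<delta>\<^sub>1 > 0" "xbar \<in> interior D \<Longrightarrow> ball xbar \<delta>\<^sub>1 \<subseteq> D"
    by (metis mem_interior zero_less_one)
  define \<delta> where "\<delta> = Min {\<delta>\<^sub>0, \<delta>\<^sub>1, 1, B powr (1 / \<alpha>)}"
  have \<delta>: "\<delta> > 0" "\<delta> \<le> \<delta>\<^sub>0" "\<delta> \<le> \<delta>\<^sub>1" "\<delta> \<le> 1" "\<delta> \<le> B powr (1 / \<alpha>)"
    using \<delta>0 \<delta>1 B by (simp_all add: \<delta>_def)
  have small: "\<bar>e\<bar> powr \<alpha> \<le> B" if "\<bar>e\<bar> < \<delta>" for e
  proof -
    have "\<bar>e\<bar> powr \<alpha> \<le> (B powr (1 / \<alpha>)) powr \<alpha>"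
      using that \<delta>(5) assms(5) by (intro powr_mono2) auto
    then show ?thesis using B assms(5) by (simp add: powr_powr)
  qed
  have order: "\<bar>newton_step D xbar \<alpha> f y - xbar\<bar> \<le> M * \<bar>y - xbar\<bar> powr (\<alpha> + 1)"
    if y: "y \<in> ?X" "\<bar>y - xbar\<bar> < \<delta>" for y
  proof -
    have "\<bar>rpow (y - xbar) (\<alpha> + 1)\<bar> = \<bar>y - xbar\<bar> powr (\<alpha> + 1)"
    proof (cases "\<alpha> = 1")
      case False
      then have "y \<ge> xbar" using y(1) by (simp add: caputo_dom_def)
      then show ?thesis using assms(5) by (simp add: rpow_nonneg_base)
    qed (simp add: rpow_def power_abs)
    moreover have "\<bar>y - xbar\<bar> powr (2 * \<alpha> + 1) \<le> \<bar>y - xbar\<bar> powr (\<alpha> + 1)"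
      using y(2) \<delta>(4) assms(5) by (intro powr_mono') auto
    then have "N * \<bar>y - xbar\<bar> powr (2 * \<alpha> + 1) \<le> N * \<bar>y - xbar\<bar> powr (\<alpha> + 1)"
      using N by (intro mult_left_mono)
    moreover have "\<bar>newton_step D xbar \<alpha> f y - xbar - A * rpow (y - xbar) (\<alpha> + 1)\<bar>
         \<le> N * \<bar>y - xbar\<bar> powr (2 * \<alpha> + 1)"
      using expansion[OF y(1)] y(2) \<delta>(2) by simp
    moreover from calculation have
      "\<bar>A * rpow (y - xbar) (\<alpha> + 1)\<bar> = \<bar>A\<bar> * \<bar>y - xbar\<bar> powr (\<alpha> + 1)"
      by (simp only: abs_mult)
    ultimately show ?thesis unfolding M_def distrib_right by linarith
  qed
  have half: "M * \<bar>e\<bar> powr (\<alpha> + 1) \<le> \<bar>e\<bar> / 2" if "\<bar>e\<bar> < \<delta>" for e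
  proof -
    have "\<bar>e\<bar> powr \<alpha> \<le> 1 / (2 * (M + 1))"
      using small[OF that] by (auto simp: B_def split: if_splits)
    then have "(M + 1) * \<bar>e\<bar> powr \<alpha> \<le> 1 / 2" using M by (simp add: field_simps)
    then have "M * \<bar>e\<bar> powr \<alpha> \<le> 1 / 2"
      using powr_ge_zero[of "\<bar>e\<bar>" \<alpha>] unfolding distrib_right by linarith
    then have "(M * \<bar>e\<bar> powr \<alpha>) * \<bar>e\<bar> \<le> 1 / 2 * \<bar>e\<bar>" by (intro mult_right_mono) auto
    then show ?thesis by (simp add: powr_add mult.assoc)
  qed
  have contracts: "\<bar>newton_step D xbar \<alpha> f y - xbar\<bar> \<le> \<bar>y - xbar\<bar> / 2"
    if "y \<in> ?X" "\<bar>y - xbar\<bar> < \<delta>" for y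
    using order[OF that] half[OF that(2)] by (rule order_trans)
  have shrinks: "\<bar>newton_step D xbar \<alpha> f y - xbar\<bar> \<le> \<bar>y - xbar\<bar>"
    if "y \<in> ?X" "\<bar>y - xbar\<bar> < \<delta>" for y
    by (rule order_trans[OF contracts[OF that]]) simp
  \<comment> \<open>For order 1 the next iterate stays in a ball inside \<open>D\<close>. Below
    order 1 a positive leading coefficient keeps it at or to the right of \<open>xbar\<close>; as
    the error does not grow, it lies between \<open>xbar\<close> and \<open>y\<close>, hence in the
    interval \<open>D\<close>.\<close>
  have stays: "newton_step D xbar \<alpha> f y \<in> ?X"
    if y: "y \<in> ?X" "\<bar>y - xbar\<bar> < \<delta>"
      and C: "(\<alpha> = 1 \<and> xbar \<in> interior D) \<or> (\<alpha> < 1 \<and> C2 D xbar \<alpha> f > 0)" for y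
    using C
  proof
    assume *: "\<alpha> = 1 \<and> xbar \<in> interior D"
    have "\<bar>newton_step D xbar \<alpha> f y - xbar\<bar> < \<delta>\<^sub>1"
      using shrinks[OF y] y(2) \<delta>(3) by (meson le_less_trans less_le_trans)
    then have "newton_step D xbar \<alpha> f y \<in> ball xbar \<delta>\<^sub>1"
      by (simp add: dist_real_def abs_minus_commute)
    then show ?thesis
      using * \<delta>1(2) by (auto simp: caputo_dom_def)
  next
    assume *: "\<alpha> < 1 \<and> C2 D xbar \<alpha> f > 0"
    define e where "e = y - xbar"
    have y': "y \<in> D" "e \<ge> 0" using y(1) * by (simp_all add: caputo_dom_def e_def)
    \<comment> \<open>This is where \<open>Gamma_sq_less\<close> enters: it gives \<open>A\<close>
      the sign of \<open>C2\<close>.\<close>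
    have A: "A > 0"
      unfolding A_def using * Gamma_sq_less[OF assms(5)] assms(5)
      by (intro mult_pos_pos divide_pos_pos zero_less_power Gamma_real_pos) auto
    have "N * e powr \<alpha> \<le> A"
    proof -
      have "e powr \<alpha> \<le> A / (N + 1)"
        using small[OF y(2)] A y'(2) by (simp add: B_def e_def)
      then have "(N + 1) * e powr \<alpha> \<le> A" using N by (simp add: field_simps)
      then show ?thesis using powr_ge_zero[of e \<alpha>] unfolding distrib_right by linarith
    qed
    then have "N * e powr \<alpha> * e powr (\<alpha> + 1) \<le> A * e powr (\<alpha> + 1)"
      by (intro mult_right_mono) auto
    moreover have "e powr \<alpha> * e powr (\<alpha> + 1) = e powr (2 * \<alpha> + 1)"
      by (simp add: powr_add[symmetric])
    ultimately have "N * e powr (2 * \<alpha> + 1) \<le> A * rpow e (\<alpha> + 1)"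
      using y'(2) assms(5) by (simp add: rpow_nonneg_base mult.assoc)
    moreover have "\<bar>newton_step D xbar \<alpha> f y - xbar - A * rpow e (\<alpha> + 1)\<bar> \<le> N * e powr (2 * \<alpha> + 1)"
      using expansion[OF y(1)] y(2) \<delta>(2) y'(2) by (simp add: e_def)
    ultimately have "newton_step D xbar \<alpha> f y \<ge> xbar" by linarith
    moreover have "newton_step D xbar \<alpha> f y \<le> y"
      using abs_le_D1[OF shrinks[OF y]] y'(2) by (simp add: e_def)
    ultimately show ?thesis
      using mem_is_interval_1_I[OF assms(1,2) y'(1)] * by (simp add: caputo_dom_def)
  qed
  have near: "\<bar>x k - xbar\<bar> < \<delta>"
    if run: "newton_run D xbar \<alpha> f x" "\<bar>x 0 - xbar\<bar> < \<delta>" and "\<forall>i\<le>k. x i \<in> ?X" for x k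
    using that(3)
  proof (induction k)
    case (Suc k)
    then have IH: "x k \<in> ?X" "\<bar>x k - xbar\<bar> < \<delta>" by auto
    have "x (Suc k) = newton_step D xbar \<alpha> f (x k)"
      using run(1) Suc.prems by (auto simp: newton_run_def)
    then show ?case using le_less_trans[OF shrinks[OF IH] IH(2)] by simp
  qed (use run in simp)
  show ?thesis
  proof (rule exI[of _ \<delta>], rule conjI[OF \<delta>(1)], rule exI[of _ M], rule exI[of _ N],
      intro conjI allI impI; elim conjE)
    fix x k assume run: "newton_run D xbar \<alpha> f x" "\<bar>x 0 - xbar\<bar> < \<delta>"
    show "x k \<in> ?X" if C: "(\<alpha> = 1 \<and> xbar \<in> interior D) \<or> (\<alpha> < 1 \<and> C2 D xbar \<alpha> f > 0)"
    \<comment> \<open>Strong induction, because \<open>newton_run\<close> prescribes the next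
      iterate only if all earlier ones lie in the domain.\<close>
    proof (induction k rule: less_induct)
      case (less k)
      show ?case
      proof (cases k)
        case 0
        then show ?thesis using run(1) by (simp add: newton_run_def)
      next
        case (Suc j)
        then have j: "\<forall>i\<le>j. x i \<in> ?X" using less by auto
        then have "x k = newton_step D xbar \<alpha> f (x j)"
          using run(1) Suc by (auto simp: newton_run_def)
        then show ?thesis using stays[OF _ near[OF run j] C] j by simp
      qed
    qed
    assume dom: "\<forall>i\<le>k. x i \<in> ?X"
    then have k: "x k \<in> ?X" "\<bar>x k - xbar\<bar> < \<delta>\<^sub>0"
      using near[OF run dom] \<delta>(2) by auto
    have Suc_k: "x (Suc k) = newton_step D xbar \<alpha> f (x k)"
      using run(1) dom by (auto simp: newton_run_def)
    show "?g (x k) \<noteq> 0"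
      using expansion[OF k] by blast
    show "0 \<le> newton_radicand D xbar \<alpha> f (x k)" if "\<alpha> < 1"
      using expansion[OF k] that by blast
    show "\<bar>x (Suc k) - xbar\<bar> \<le> M * \<bar>x k - xbar\<bar> powr (\<alpha> + 1)"
      unfolding Suc_k by (rule order[OF k(1) near[OF run dom]])
    show "\<bar>(x (Suc k) - xbar) -
            (Gamma (2 * \<alpha> + 1) - (Gamma (\<alpha> + 1))\<^sup>2) / (\<alpha> * (Gamma (\<alpha> + 1))\<^sup>2)
              * C2 D xbar \<alpha> f * rpow (x k - xbar) (\<alpha> + 1)\<bar>
           \<le> N * \<bar>x k - xbar\<bar> powr (2 * \<alpha> + 1)"
      unfolding Suc_k A_def[symmetric] using expansion[OF k] by blast
  next
    fix x assume run: "newton_run D xbar \<alpha> f x" "\<bar>x 0 - xbar\<bar> < \<delta>" and dom: "\<forall>k. x k \<in> ?X"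
    have Suc_k: "x (Suc k) = newton_step D xbar \<alpha> f (x k)" for k
      using run(1) dom by (auto simp: newton_run_def)
    show "conv_order_at_least x xbar (\<alpha> + 1)"
    proof (rule conv_order_at_leastI)
      show "\<bar>x (Suc k) - xbar\<bar> \<le> M * \<bar>x k - xbar\<bar> powr (\<alpha> + 1)" for k
        unfolding Suc_k using dom near[OF run] by (intro order) auto
      show "\<bar>x (Suc k) - xbar\<bar> \<le> \<bar>x k - xbar\<bar> / 2" for k
        unfolding Suc_k using dom near[OF run] by (intro contracts) auto
    qed
  qed
qed

end
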